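(* Let $p,q,k,n\in\mathbb{N}$ with $n\le\lfloor\frac{p}{k+1}\rfloor(q+1)+q+k-1$ and $p\ge k+1$. Then every $n$-vertex graph $G$ with $\mathrm{tw}(G)\le k$ has a set $S$ of at most $p$ vertices such that each component of $G-S$ has at most $q$ vertices.
   Context: $\mathrm{tw}$ denotes tree-width. *)

theory Defs
  imports Graph_Theory.Digraph_Component
begin

text \<open>
  Finite simple undirected graphs are the library's \<open>graph\<close>: finite, loop-free symmetric digraphs
  without parallel arcs, each edge being represented by two opposite arcs. The null graph is
  allowed. For these, \<open>sccs\<close> consists of the usual connected components.

  The library's \<open>tree\<close> is not suitable here: in a symmetric digraph, \<open>u, v, u\<close> counts as a
  \<open>cycle\<close>, so no such graph with an edge would be a tree. The cycles of a simple undirected graph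
  are exactly those of length at least 3.
\<close>

definition undirected_tree :: "('t, 'e) pre_digraph \<Rightarrow> bool" where
  "undirected_tree T \<longleftrightarrow>
     graph T \<and> connected T \<and> \<not> (\<exists>c. pre_digraph.cycle T c \<and> length c \<ge> 3)"

text \<open>
  Since \<open>connected\<close> includes having at least one vertex, the last condition says that the tree
  nodes whose bags contain \<open>v\<close> induce a nonempty subtree.
\<close>

definition tree_decomposition ::
  "('a, 'b) pre_digraph \<Rightarrow> ('t, 'e) pre_digraph \<Rightarrow> ('t \<Rightarrow> 'a set) \<Rightarrow> bool" where
  "tree_decomposition G T B \<longleftrightarrow>
     undirected_tree T \<and>
     (\<forall>x \<in> verts T. B x \<subseteq> verts G) \<and>
     (\<forall>u v. u \<rightarrow>\<^bsub>G\<^esub> v \<longrightarrow> (\<exists>x \<in> verts T. u \<in> B x \<and> v \<in> B x)) \<and>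
     (\<forall>v \<in> verts G. connected (T \<restriction> {x \<in> verts T. v \<in> B x}))"

definition decomposition_width :: "('t, 'e) pre_digraph \<Rightarrow> ('t \<Rightarrow> 'a set) \<Rightarrow> int" where
  "decomposition_width T B = int (Max ((\<lambda>x. card (B x)) ` verts T)) - 1"

text \<open>
  Every finite tree is isomorphic to one whose nodes are natural numbers, so fixing the node type
  loses no generality. The infimum is a minimum, as widths are integers bounded below by \<open>-1\<close>;
  the null graph has tree-width \<open>-1\<close>.
\<close>

definition treewidth :: "('a, 'b) pre_digraph \<Rightarrow> int" where
  "treewidth G =
     Inf {decomposition_width (with_proj T) B | (T :: nat pair_pre_digraph) B.
            tree_decomposition G (with_proj T) B}"

end

theory Submission
  imports Defs
begin

text \<open>
  Root a tree decomposition of width at most \<open>k\<close>. Let \<open>x\<close> be a deepest node such that more than \<open>q\<close>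
  vertices occur in the subtree of \<open>x\<close> but not in the bag of its parent. Deleting the bag of \<open>x\<close>
  (at most \<open>k + 1\<close> vertices) cuts the at least \<open>q + 1\<close> vertices \<open>A\<close> of this subtree into pieces of
  size at most \<open>q\<close>, and one continues with the vertices outside \<open>A\<close>. After all but the last of the
  \<open>p div (k + 1)\<close> rounds at most \<open>2 * q + k\<close> vertices are left. If in the last round more than \<open>q\<close>
  vertices lie outside \<open>A\<close>, the bag of \<open>x\<close> is not used; instead, as the intersection \<open>Z\<close> of \<open>A\<close> with
  the parent bag separates \<open>A - Z\<close> from the vertices outside \<open>A\<close> and both sides have more than \<open>q\<close>
  vertices, one may keep any \<open>q\<close> vertices on each side and delete the at most \<open>k\<close> others.
\<close>

section \<open>Splitting along a rooted decomposition\<close>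

text \<open>This bounds the components of the subgraph induced by \<open>W\<close> without mentioning
  reachability: it asks for a small superset of each component that is closed under adjacency.\<close>

definition small_pieces :: "('a \<times> 'a) set \<Rightarrow> nat \<Rightarrow> 'a set \<Rightarrow> bool" where
  "small_pieces E q W \<longleftrightarrow>
     (\<forall>u\<in>W. \<exists>C\<subseteq>W. u \<in> C \<and> card C \<le> q \<and> (\<forall>a\<in>C. \<forall>b\<in>W. (a, b) \<in> E \<longrightarrow> b \<in> C))"

lemma small_piecesI_card: "card W \<le> q \<Longrightarrow> small_pieces E q W"
  unfolding small_pieces_def by auto

lemma small_piecesE:
  assumes "small_pieces E q W" "u \<in> W"
  obtains C where "C \<subseteq> W" "u \<in> C" "card C \<le> q"
    "\<And>a b. a \<in> C \<Longrightarrow> b \<in> W \<Longrightarrow> (a, b) \<in> E \<Longrightarrow> b \<in> C"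
  using assms unfolding small_pieces_def by meson

text \<open>A closed set chosen in one part stays closed in the union, as no edge leads to the other
  part.\<close>

lemma small_pieces_Un:
  assumes sym: "sym E" and small: "small_pieces E q W1" "small_pieces E q W2"
    and no_edge: "\<And>a b. a \<in> W1 \<Longrightarrow> b \<in> W2 \<Longrightarrow> (a, b) \<notin> E"
  shows "small_pieces E q (W1 \<union> W2)"
  unfolding small_pieces_def
proof
  fix u assume u: "u \<in> W1 \<union> W2"
  have no_edge': "(b, a) \<notin> E" if "a \<in> W1" "b \<in> W2" for a b
    using no_edge[OF that] symD[OF sym] by metis
  obtain C where C: "C \<subseteq> W1 \<union> W2" "u \<in> C" "card C \<le> q"
    and closed: "\<And>a b. a \<in> C \<Longrightarrow> b \<in> W1 \<union> W2 \<Longrightarrow> (a, b) \<in> E \<Longrightarrow> b \<in> C"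
  proof (cases "u \<in> W1")
    case True
    obtain C where C: "C \<subseteq> W1" "u \<in> C" "card C \<le> q"
      and closed: "\<And>a b. a \<in> C \<Longrightarrow> b \<in> W1 \<Longrightarrow> (a, b) \<in> E \<Longrightarrow> b \<in> C"
      using small_piecesE[OF small(1) True] by metis
    show ?thesis
    proof (rule that[of C])
      show "b \<in> C" if "a \<in> C" "b \<in> W1 \<union> W2" "(a, b) \<in> E" for a b
        using that closed no_edge[of a b] C(1) by auto
    qed (use C in auto)
  next
    case False
    then have "u \<in> W2" using u by simp
    then obtain C where C: "C \<subseteq> W2" "u \<in> C" "card C \<le> q"
      and closed: "\<And>a b. a \<in> C \<Longrightarrow> b \<in> W2 \<Longrightarrow> (a, b) \<in> E \<Longrightarrow> b \<in> C"
      using small_piecesE[OF small(2)] by metis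
    show ?thesis
    proof (rule that[of C])
      show "b \<in> C" if "a \<in> C" "b \<in> W1 \<union> W2" "(a, b) \<in> E" for a b
        using that closed no_edge'[of b a] C(1) by auto
    qed (use C in auto)
  qed
  then show "\<exists>C\<subseteq>W1 \<union> W2. u \<in> C \<and> card C \<le> q \<and>
      (\<forall>a\<in>C. \<forall>b\<in>W1 \<union> W2. (a, b) \<in> E \<longrightarrow> b \<in> C)" by metis
qed

text \<open>\<open>P\<close> relates each node of the decomposition tree to its parent and \<open>d\<close> is the depth.\<close>

locale rooted_decomposition =
  fixes V :: "'a set" and E :: "('a \<times> 'a) set"
    and N :: "'t set" and P :: "('t \<times> 't) set" and d :: "'t \<Rightarrow> nat" and r :: 't
    and B :: "'t \<Rightarrow> 'a set"
  assumes finite_V: "finite V" and sym_E: "sym E"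
    and finite_N: "finite N" and root: "r \<in> N"
    and parent_in_N: "P \<subseteq> N \<times> N" and parent_unique: "single_valued P"
    and reach_root: "x \<in> N \<Longrightarrow> (x, r) \<in> P\<^sup>*"
    and root_no_parent: "(r, x) \<notin> P"
    and depth_less: "(x, y) \<in> P \<Longrightarrow> d y < d x"
    and vertex_in_bag: "v \<in> V \<Longrightarrow> \<exists>x\<in>N. v \<in> B x"
    and edge_in_bag: "(u, v) \<in> E \<Longrightarrow> \<exists>x\<in>N. u \<in> B x \<and> v \<in> B x"
    and separation: "\<lbrakk>(x, w) \<in> P; (y, x) \<in> P\<^sup>*; v \<in> B y; z \<in> N; (z, x) \<notin> P\<^sup>*; v \<in> B z\<rbrakk>
      \<Longrightarrow> v \<in> B x \<and> v \<in> B w"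
begin

definition below :: "'t \<Rightarrow> 'a set" where
  "below x = (\<Union>y \<in> {y. (y, x) \<in> P\<^sup>*}. B y)"

text \<open>As a union over at most one parent it is empty at the root, so the root needs no
  separate treatment.\<close>

definition parent_bag :: "'t \<Rightarrow> 'a set" where
  "parent_bag x = (\<Union>w \<in> P `` {x}. B w)"

lemma parent_bag_eq: "(x, w) \<in> P \<Longrightarrow> parent_bag x = B w"
  using parent_unique unfolding parent_bag_def single_valued_def by auto

lemma parent_bag_root: "parent_bag r = {}"
  using root_no_parent unfolding parent_bag_def by auto

lemma below_root: "V \<subseteq> below r"
  using vertex_in_bag reach_root unfolding below_def by blast

text \<open>A bag holding both ends belongs to a node outside the subtree of \<open>x\<close>. Hence
  \<open>a\<close> occurs on both sides of the tree edge from \<open>x\<close> to its parent, and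
  \<open>separation\<close> applies.\<close>

lemma edge_leaving_below:
  assumes "x \<in> N" "(a, b) \<in> E" "a \<in> below x" "b \<notin> below x"
  shows "a \<in> B x \<and> a \<in> parent_bag x"
proof -
  obtain z where z: "z \<in> N" "a \<in> B z" "b \<in> B z" using edge_in_bag assms(2) by blast
  have nz: "(z, x) \<notin> P\<^sup>*" using z assms(4) unfolding below_def by blast
  obtain y where y: "(y, x) \<in> P\<^sup>*" "a \<in> B y" using assms(3) unfolding below_def by blast
  have "x \<noteq> r" using nz reach_root z by blast
  then obtain w where w: "(x, w) \<in> P" using reach_root[OF assms(1)] by (meson converse_rtranclE)
  from separation[OF w y z(1) nz z(2)] show ?thesis using parent_bag_eq[OF w] by simp
qed

text \<open>That \<open>x\<close> satisfies the size condition \<open>Q\<close> makes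
  \<open>A\<close> and \<open>A - Z\<close> large; that no deeper node does makes the pieces
  small.\<close>

lemma split_step:
  assumes R: "R \<subseteq> V" and big: "q < card R"
  obtains x A where "x \<in> N" "A \<subseteq> R" "R \<inter> B x \<subseteq> A" "q < card A"
    "small_pieces E q (A - B x)" "\<forall>a\<in>A - B x. \<forall>b\<in>R - A. (a, b) \<notin> E"
    "\<exists>Z\<subseteq>A. q < card (A - Z) \<and> (\<forall>a\<in>A - Z. \<forall>b\<in>R - A. (a, b) \<notin> E)"
proof -
  define Q where "Q x \<longleftrightarrow> x \<in> N \<and> q < card (R \<inter> below x - parent_bag x)" for x
  have "R \<inter> below r = R" using below_root R by blast
  then have Qr: "Q r" using big root unfolding Q_def parent_bag_root by simp
  have fin: "finite (Collect Q)" using finite_N unfolding Q_def by simp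
  have "Max (d ` Collect Q) \<in> d ` Collect Q" using fin Qr by (intro Max_in) auto
  then obtain x where x: "Q x" "d x = Max (d ` Collect Q)" by auto
  have deepest: "d y \<le> d x" if "Q y" for y unfolding x(2) using fin that by (intro Max_ge) auto
  have xN: "x \<in> N" using x unfolding Q_def by simp
  define A where "A = R \<inter> below x"
  have finR: "finite R" using R finite_V finite_subset by blast
  have 1: "R \<inter> B x \<subseteq> A" unfolding A_def below_def by blast
  have 2: "q < card A"
    using x(1) card_mono[of A "A - parent_bag x"] finR unfolding Q_def A_def by fastforce
  have 3: "\<forall>a\<in>A - B x. \<forall>b\<in>R - A. (a, b) \<notin> E"
    using edge_leaving_below[OF xN] unfolding A_def by blast
  have 4: "\<exists>Z\<subseteq>A. q < card (A - Z) \<and> (\<forall>a\<in>A - Z. \<forall>b\<in>R - A. (a, b) \<notin> E)"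
  proof (intro exI conjI ballI)
    show "A \<inter> parent_bag x \<subseteq> A" by simp
    show "q < card (A - A \<inter> parent_bag x)"
      using x(1) unfolding Q_def A_def by (simp add: Diff_Int_distrib Diff_Int)
    show "(a, b) \<notin> E" if "a \<in> A - A \<inter> parent_bag x" "b \<in> R - A" for a b
      using edge_leaving_below[OF xN] that unfolding A_def by blast
  qed
  have "small_pieces E q (A - B x)"
    unfolding small_pieces_def
  proof
    fix u assume u: "u \<in> A - B x"
    then obtain y where y: "(y, x) \<in> P\<^sup>*" "u \<in> B y" unfolding A_def below_def by blast
    \<comment> \<open>As \<open>u\<close> is not in \<open>B x\<close>, it lies below some child
      \<open>c\<close> of \<open>x\<close>. Its piece is the part of \<open>R\<close> below
      \<open>c\<close> outside \<open>B x\<close>, the parent bag of \<open>c\<close>; this is small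
      because \<open>c\<close> is deeper than \<open>x\<close>.\<close>
    with u have "y \<noteq> x" by blast
    with y obtain c where c: "(y, c) \<in> P\<^sup>*" "(c, x) \<in> P" by (meson rtranclE)
    then have cN: "c \<in> N" using parent_in_N by blast
    have "\<not> Q c" using deepest[of c] depth_less[OF c(2)] by linarith
    then have card: "card (R \<inter> below c - B x) \<le> q"
      using cN parent_bag_eq[OF c(2)] unfolding Q_def by simp
    have sub: "below c \<subseteq> below x"
      unfolding below_def using c(2) by (auto intro: rtrancl_into_rtrancl)
    \<comment> \<open>Edges leaving the subtree of \<open>c\<close> start in its parent bag
      \<open>B x\<close>, which the piece avoids.\<close>
    have "b \<in> below c" if "a \<in> R \<inter> below c - B x" "(a, b) \<in> E" for a b
      using edge_leaving_below[OF cN that(2)] that parent_bag_eq[OF c(2)] by blast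
    then show "\<exists>C\<subseteq>A - B x. u \<in> C \<and> card C \<le> q \<and>
        (\<forall>a\<in>C. \<forall>b\<in>A - B x. (a, b) \<in> E \<longrightarrow> b \<in> C)"
      using card sub u y c unfolding A_def
      by (intro exI[of _ "R \<inter> below c - B x"]) (auto simp: below_def)
  qed
  with xN 1 2 3 4 that[of x A] show ?thesis unfolding A_def by blast
qed

text \<open>Induction on the number of rounds: each further round deletes at most
  \<open>k + 1\<close> vertices and disposes of at least \<open>q + 1\<close>, which matches the
  growth of both bounds.\<close>

lemma small_pieces_after_deletion:
  assumes bags: "\<And>x. x \<in> N \<Longrightarrow> card (R \<inter> B x) \<le> k + 1"
    and "R \<subseteq> V" "t \<ge> 1" "card R < t * (q + 1) + q + k"
  shows "\<exists>S\<subseteq>R. card S \<le> t * (k + 1) \<and> small_pieces E q (R - S)"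
  using assms(3,1,2,4)
proof (induction t arbitrary: R rule: nat_induct_at_least)
  case (base R)
  have finR: "finite R" using finite_subset[OF base(2) finite_V] .
  show ?case
  proof (cases "card R \<le> q")
    case True
    then show ?thesis by (intro exI[of _ "{}"]) (simp add: small_piecesI_card)
  next
    case False
    then have "q < card R" by simp
    from split_step[OF base(2) this] obtain x A where x: "x \<in> N" "A \<subseteq> R" "R \<inter> B x \<subseteq> A" "q < card A"
      "small_pieces E q (A - B x)" "\<forall>a\<in>A - B x. \<forall>b\<in>R - A. (a, b) \<notin> E"
      "\<exists>Z\<subseteq>A. q < card (A - Z) \<and> (\<forall>a\<in>A - Z. \<forall>b\<in>R - A. (a, b) \<notin> E)"
      by metis
    show ?thesis
    proof (cases "card (R - A) \<le> q")
      case True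
      have "small_pieces E q ((A - B x) \<union> (R - A))"
        using x(6) by (intro small_pieces_Un sym_E x(5) small_piecesI_card True) blast
      moreover have "R - R \<inter> B x = (A - B x) \<union> (R - A)" using x(2,3) by blast
      ultimately show ?thesis using base(1) x(1) by (intro exI[of _ "R \<inter> B x"]) simp
    next
      case False
      obtain Z where Z: "Z \<subseteq> A" "q < card (A - Z)" "\<forall>a\<in>A - Z. \<forall>b\<in>R - A. (a, b) \<notin> E"
        using x(7) by blast
      obtain C where C: "C \<subseteq> A - Z" "card C = q" "finite C"
        using obtain_subset_with_card_n[of q "A - Z"] Z(2) by auto
      obtain D where D: "D \<subseteq> R - A" "card D = q" "finite D"
        using obtain_subset_with_card_n[of q "R - A"] False by auto
      have CD: "C \<union> D \<subseteq> R" "C \<inter> D = {}" using C D x(2) by auto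
      \<comment> \<open>For \<open>t = 1\<close> the bound reads
        \<open>card R < 2 * q + k + 1\<close>, so at most \<open>k\<close> vertices are deleted
        here.\<close>
      then have "card (R - (C \<union> D)) = card R - 2 * q"
        using C D by (simp add: card_Diff_subset card_Un_disjoint)
      moreover have "small_pieces E q (C \<union> D)"
        using C D Z(3) by (intro small_pieces_Un sym_E) (auto intro: small_piecesI_card)
      moreover have "R - (R - (C \<union> D)) = C \<union> D" using CD by blast
      ultimately show ?thesis using base(3) by (intro exI[of _ "R - (C \<union> D)"]) auto
    qed
  qed
next
  case (Suc t R)
  have finR: "finite R" using finite_subset[OF Suc.prems(2) finite_V] .
  show ?case
  proof (cases "card R \<le> q")
    case True
    then show ?thesis by (intro exI[of _ "{}"]) (simp add: small_piecesI_card)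
  next
    case False
    then have "q < card R" by simp
    from split_step[OF Suc.prems(2) this] obtain x A where x: "x \<in> N" "A \<subseteq> R" "R \<inter> B x \<subseteq> A" "q < card A"
      "small_pieces E q (A - B x)" "\<forall>a\<in>A - B x. \<forall>b\<in>R - A. (a, b) \<notin> E"
      by metis
    have bags: "card ((R - A) \<inter> B y) \<le> k + 1" if "y \<in> N" for y
      using Suc.prems(1)[OF that] card_mono[of "R \<inter> B y" "(R - A) \<inter> B y"] finR by fastforce
    have small: "card (R - A) < t * (q + 1) + q + k"
      using Suc.prems(3) x(4) card_mono[OF finR x(2)] finite_subset[OF x(2) finR]
      by (simp add: card_Diff_subset x(2))
    have "R - A \<subseteq> V" using Suc.prems(2) by blast
    from Suc.IH[OF bags this small] obtain S where S: "S \<subseteq> R - A" "card S \<le> t * (k + 1)"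
      "small_pieces E q (R - A - S)"
      by blast
    have "small_pieces E q ((A - B x) \<union> (R - A - S))"
      using x(6) by (intro small_pieces_Un sym_E x(5) S(3)) blast
    \<comment> \<open>\<open>S\<close> lies outside \<open>A\<close> and
      \<open>R \<inter> B x\<close> inside, so the two deletions do not interfere.\<close>
    moreover have "R - (R \<inter> B x \<union> S) = (A - B x) \<union> (R - A - S)" using x S by blast
    moreover have "card (R \<inter> B x \<union> S) \<le> Suc t * (k + 1)"
      using card_Un_le[of "R \<inter> B x" S] Suc.prems(1)[OF x(1)] S(2) by simp
    ultimately show ?thesis using S by (intro exI[of _ "R \<inter> B x \<union> S"]) auto
  qed
qed

end

section \<open>Rooting a tree\<close>

text \<open>A path from \<open>x\<close> to \<open>y\<close> avoiding the edge would close up with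
  the arc from \<open>y\<close> to \<open>x\<close> to a cycle of length at least 3.\<close>

lemma undirected_tree_bridge:
  assumes T: "undirected_tree T" and xy: "x \<rightarrow>\<^bsub>T\<^esub> y"
  shows "(x, y) \<notin> (arcs_ends T - {(x, y), (y, x)})\<^sup>*"
proof
  assume path: "(x, y) \<in> (arcs_ends T - {(x, y), (y, x)})\<^sup>*"
  interpret T: graph T using T unfolding undirected_tree_def by simp
  define H where
    "H = T\<lparr>arcs := {a \<in> arcs T. (tail T a, head T a) \<notin> {(x, y), (y, x)}}\<rparr>"
  interpret H: wf_digraph H unfolding H_def by unfold_locales auto
  have ends: "arcs_ends H = arcs_ends T - {(x, y), (y, x)}"
    unfolding H_def arcs_ends_conv by auto
  have xH: "x \<in> verts H" using T.adj_in_verts[OF xy] unfolding H_def by simp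
  then have "x \<rightarrow>\<^sup>*\<^bsub>H\<^esub> y" using path H.reachable_conv' unfolding ends by simp
  then obtain p where p: "H.apath x p y"
    using H.reachable_awalk H.apath_awalk_to_apath by blast
  have comp: "compatible H T" unfolding compatible_def H_def by simp
  have pT: "T.awalk x p y" "set p \<subseteq> arcs H" "distinct (T.awalk_verts x p)"
    using p unfolding H.apath_def H.awalk_def T.awalk_def
      compatible_cas[OF comp] compatible_awalk_verts[OF comp] by (auto simp: H_def)
  obtain e where e: "e \<in> arcs T" "tail T e = y" "head T e = x"
    using xy T.graph_symmetric by (metis reachableE)
  have "x \<noteq> y" using xy T.adj_not_same by blast
  \<comment> \<open>A single arc from \<open>x\<close> to \<open>y\<close> is missing in
    \<open>H\<close>. So the closed walk is not the mere back and forth over one edge.\<close>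
  have "length p \<ge> 2"
  proof (rule ccontr)
    assume "\<not> length p \<ge> 2"
    then consider "p = []" | a where "p = [a]" by (cases p rule: remdups_adj.cases) auto
    then show False
      using pT(1,2) \<open>x \<noteq> y\<close> unfolding T.awalk_def H_def by cases auto
  qed
  have last: "T.awlast x p = y" and "T.awhd x p = x" using pT(1) by auto
  have "T.awalk y [e] x" using e T.tail_in_verts[OF e(1)] unfolding T.awalk_def by simp
  then have walk: "T.awalk x (p @ [e]) x" using pT(1) last by (simp add: T.awalk_append_iff)
  have "p \<noteq> []" using \<open>length p \<ge> 2\<close> by auto
  \<comment> \<open>Moving the leading \<open>x\<close> to the end only permutes the distinct
    vertices of \<open>p\<close>.\<close>
  have "T.awalk_verts x (p @ [e]) = T.awalk_verts x p @ [x]"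
    using last \<open>p \<noteq> []\<close> e by (simp add: T.awalk_verts_conv)
  moreover obtain ys where ys: "T.awalk_verts x p = x # ys"
    using \<open>T.awhd x p = x\<close> T.awalk_verts_non_Nil by (metis list.collapse)
  ultimately have "distinct (tl (T.awalk_verts x (p @ [e])))"
    using pT(3) by simp
  then have "T.cycle (p @ [e])" using walk unfolding T.cycle_def by blast
  moreover have "length (p @ [e]) \<ge> 3" using \<open>length p \<ge> 2\<close> by simp
  ultimately show False using T unfolding undirected_tree_def by blast
qed

text \<open>Parents come from breadth-first search: an edge \<open>xy\<close> that is not the parent edge of \<open>x\<close> or \<open>y\<close>
  is bypassed by the parent paths from \<open>x\<close> and \<open>y\<close> to the root, so it is not a bridge.\<close>

lemma parent_relation_exists:
  fixes E :: "('t \<times> 't) set"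
  assumes sym: "sym E" and loopfree: "\<And>x. (x, x) \<notin> E"
    and conn: "\<And>x. x \<in> Field E \<Longrightarrow> (r, x) \<in> E\<^sup>*"
    and bridge: "\<And>x y. (x, y) \<in> E \<Longrightarrow> (x, y) \<notin> (E - {(x, y), (y, x)})\<^sup>*"
  obtains P and d :: "'t \<Rightarrow> nat" where
    "E = P \<union> P\<inverse>" "single_valued P" "\<And>x. (x, r) \<in> E\<^sup>* \<Longrightarrow> (x, r) \<in> P\<^sup>*"
    "\<And>x. (r, x) \<notin> P" "\<And>x y. (x, y) \<in> P \<Longrightarrow> d y < d x"
proof -
  \<comment> \<open>Distance from \<open>r\<close>. It is unspecified for unreachable
    \<open>x\<close>, but by \<open>conn\<close> no such \<open>x\<close> lies on an edge.\<close>
  define d where "d x = (LEAST n. (r, x) \<in> E ^^ n)" for x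
  define P where "P = {(x, y) \<in> E. d x = Suc (d y)}"
  have d_le: "d x \<le> n" if "(r, x) \<in> E ^^ n" for x n
    unfolding d_def using that by (rule Least_le)
  have d_path: "(r, x) \<in> E ^^ d x" if "(r, x) \<in> E\<^sup>*" for x
    unfolding d_def using that by (metis LeastI rtrancl_imp_relpow)
  have d_r: "d r = 0" using d_le[of r 0] by simp
  have d_edge: "d y \<le> Suc (d x)" if "(x, y) \<in> E" for x y
    using that conn[of x] d_path[of x] d_le[of y "Suc (d x)"] by (auto simp: Field_def)
  \<comment> \<open>Confined to depths at most \<open>d x\<close>, the path avoids the parent edge
    of every node deeper than \<open>x\<close>.\<close>
  have to_root: "(x, r) \<in> (Restr P {z. d z \<le> d x})\<^sup>*" if "(r, x) \<in> E\<^sup>*" for x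
    using that
  proof (induction "d x" arbitrary: x)
    case 0
    then show ?case using d_path[of x] by simp
  next
    case (Suc n)
    obtain y where y: "(r, y) \<in> E ^^ n" "(y, x) \<in> E"
      using d_path[OF Suc.prems] Suc.hyps(2) by (metis relpow_Suc_E)
    then have ry: "(r, y) \<in> E\<^sup>*" using relpow_imp_rtrancl by blast
    have dy: "d y = n" using d_le[OF y(1)] d_edge[OF y(2)] Suc.hyps(2) by simp
    have "(y, r) \<in> (Restr P {z. d z \<le> d x})\<^sup>*"
    proof (rule rtrancl_mono[THEN subsetD, rotated])
      show "(y, r) \<in> (Restr P {z. d z \<le> d y})\<^sup>*" using Suc.hyps(1)[OF dy[symmetric] ry] .
      show "Restr P {z. d z \<le> d y} \<subseteq> Restr P {z. d z \<le> d x}" using Suc.hyps(2) dy by auto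
    qed
    moreover have "(x, y) \<in> Restr P {z. d z \<le> d x}"
      using symD[OF sym y(2)] dy Suc.hyps(2) unfolding P_def by auto
    ultimately show ?case by (rule converse_rtrancl_into_rtrancl[rotated])
  qed
  have symD: "(b, a) \<in> D\<^sup>*" if "(a, b) \<in> D\<^sup>*" "sym D" for a b and D :: "('t \<times> 't) set"
    using that sym_rtrancl symE by metis
  \<comment> \<open>The detour runs from \<open>x\<close> up to \<open>r\<close> and down to
    \<open>y\<close>. The edge \<open>ab\<close> may be a parent edge, provided that
    \<open>a\<close> is deeper than both \<open>x\<close> and \<open>y\<close>.\<close>
  have between: "(x, y) \<in> (E - {(a, b), (b, a)})\<^sup>*"
    if xy: "x \<in> Field E" "y \<in> Field E"
      and ab: "(a, b) \<notin> P \<or> d x < d a \<and> d y < d a" "(b, a) \<notin> P" for x y a b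
  proof -
    have *: "(z, r) \<in> (E - {(a, b), (b, a)})\<^sup>*"
      if "z \<in> Field E" "(a, b) \<notin> P \<or> d z < d a" for z
    proof -
      have "Restr P {w. d w \<le> d z} \<subseteq> E - {(a, b), (b, a)}"
        using that(2) ab(2) unfolding P_def by auto
      then show ?thesis using to_root[OF conn[OF that(1)]] rtrancl_mono by blast
    qed
    have "sym (E - {(a, b), (b, a)})" using sym unfolding sym_def by auto
    then have "(r, y) \<in> (E - {(a, b), (b, a)})\<^sup>*" using symD *[of y] xy ab by blast
    moreover have "(x, r) \<in> (E - {(a, b), (b, a)})\<^sup>*" using *[of x] xy ab by blast
    ultimately show ?thesis by (rule rtrancl_trans[rotated])
  qed
  have orient: "(x, y) \<in> P \<or> (y, x) \<in> P" if "(x, y) \<in> E" for x y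
  proof (rule ccontr)
    assume "\<not> ((x, y) \<in> P \<or> (y, x) \<in> P)"
    then have "(x, y) \<in> (E - {(x, y), (y, x)})\<^sup>*"
      using that between[of x y x y] by (auto simp: Field_def)
    then show False using bridge[OF that] by simp
  qed
  \<comment> \<open>A second parent \<open>y'\<close> would give a bypass of the edge
    \<open>xy\<close>: step to \<open>y'\<close>, then go through the root to
    \<open>y\<close>.\<close>
  have "y = y'" if "(x, y) \<in> P" "(x, y') \<in> P" for x y y'
  proof (rule ccontr)
    assume "y \<noteq> y'"
    have E: "(x, y) \<in> E" "(x, y') \<in> E" "d x = Suc (d y)" "d x = Suc (d y')"
      using that unfolding P_def by auto
    then have "(y', y) \<in> (E - {(x, y), (y, x)})\<^sup>*"
      using between[of y' y x y] by (auto simp: Field_def P_def)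
    moreover have "(x, y') \<in> E - {(x, y), (y, x)}" using E \<open>y \<noteq> y'\<close> loopfree by auto
    ultimately have "(x, y) \<in> (E - {(x, y), (y, x)})\<^sup>*"
      by (rule converse_rtrancl_into_rtrancl[rotated])
    then show False using bridge[OF E(1)] by simp
  qed
  then have "single_valued P" unfolding single_valued_def by blast
  moreover have "E = P \<union> P\<inverse>" using orient sym unfolding P_def sym_def by auto
  moreover have "(x, r) \<in> P\<^sup>*" if "(x, r) \<in> E\<^sup>*" for x
    using to_root[OF symD[OF that sym]] rtrancl_mono[of "Restr P {z. d z \<le> d x}" P] by blast
  moreover have "(r, x) \<notin> P" for x using d_r unfolding P_def by simp
  moreover have "d y < d x" if "(x, y) \<in> P" for x y using that unfolding P_def by simp
  ultimately show ?thesis using that by blast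
qed

lemma rtrancl_crossing:
  assumes "(y, z) \<in> F\<^sup>*" "y \<in> D" "z \<notin> D"
  obtains a b where "(a, b) \<in> F" "a \<in> D" "b \<notin> D"
  using assms by (induction rule: rtrancl_induct) auto

text \<open>Separation comes from the connectedness of the nodes whose bags contain
  \<open>v\<close>: a walk through them that leaves the subtree of \<open>x\<close> must use the
  edge from \<open>x\<close> to its parent.\<close>

lemma rooted_decomposition_exists:
  fixes G :: "('a, 'b) pre_digraph" and T :: "('t, 'e) pre_digraph"
  assumes G: "graph G" and td: "tree_decomposition G T B"
  obtains P d r where "rooted_decomposition (verts G) (arcs_ends G) (verts T) P d r B"
proof -
  have tree: "undirected_tree T" using td unfolding tree_decomposition_def by simp
  then have "graph T" "connected T" unfolding undirected_tree_def by auto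
  interpret G: graph G by fact
  interpret T: graph T by fact
  have sc: "strongly_connected T"
    using T.symmetric_connected_imp_strongly_connected[OF T.sym_arcs \<open>connected T\<close>] .
  then obtain r where r: "r \<in> verts T" unfolding strongly_connected_def by blast
  have reach: "(x, y) \<in> (arcs_ends T)\<^sup>*" if "x \<in> verts T" "y \<in> verts T" for x y
    using sc that reachable_rtranclI[of T x y] unfolding strongly_connected_def by simp
  have "sym (arcs_ends T)" using T.sym_arcs unfolding symmetric_def .
  moreover have "(x, x) \<notin> arcs_ends T" for x using T.adj_not_same by blast
  moreover have "(r, x) \<in> (arcs_ends T)\<^sup>*" if "x \<in> Field (arcs_ends T)" for x
    using that reach[OF r] T.adj_in_verts by (auto simp: Field_def)
  ultimately obtain P and d :: "'t \<Rightarrow> nat" where P: "arcs_ends T = P \<union> P\<inverse>" "single_valued P"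
    "\<And>x. (x, r) \<in> (arcs_ends T)\<^sup>* \<Longrightarrow> (x, r) \<in> P\<^sup>*"
    "\<And>x. (r, x) \<notin> P" "\<And>x y. (x, y) \<in> P \<Longrightarrow> d y < d x"
    using undirected_tree_bridge[OF tree] by (rule parent_relation_exists[of "arcs_ends T" r]) blast+
  have in_T: "x \<in> verts T" "y \<in> verts T" if "(x, y) \<in> P" for x y
    using T.adj_in_verts[of x y] that P(1) by simp_all
  have conn: "connected (T \<restriction> {x \<in> verts T. v \<in> B x})" if "v \<in> verts G" for v
    using td that unfolding tree_decomposition_def by blast
  have "rooted_decomposition (verts G) (arcs_ends G) (verts T) P d r B"
  proof (rule rooted_decomposition.intro)
    show "P \<subseteq> verts T \<times> verts T" using in_T by auto
    show "sym (arcs_ends G)" using G.sym_arcs unfolding symmetric_def .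
    show "\<exists>x\<in>verts T. v \<in> B x" if "v \<in> verts G" for v
      using conn[OF that] unfolding connected_def strongly_connected_def by auto
    show "\<exists>x\<in>verts T. u \<in> B x \<and> v \<in> B x" if "(u, v) \<in> arcs_ends G" for u v
      using td that unfolding tree_decomposition_def by blast
    show "(x, r) \<in> P\<^sup>*" if "x \<in> verts T" for x using P(3) reach[OF that r] .
  next
    fix x w y v z
    assume xw: "(x, w) \<in> P" and yx: "(y, x) \<in> P\<^sup>*" and vy: "v \<in> B y"
      and z: "z \<in> verts T" and zx: "(z, x) \<notin> P\<^sup>*" and vz: "v \<in> B z"
    have y: "y \<in> verts T"
      using yx in_T(1)[OF xw] by (induction rule: converse_rtrancl_induct) (auto intro: in_T)
    have v: "v \<in> verts G" using y vy td unfolding tree_decomposition_def by blast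
    define H where "H = T \<restriction> {x \<in> verts T. v \<in> B x}"
    \<comment> \<open>\<open>connected\<close> is defined through \<open>mk_symmetric\<close>; as
      \<open>T\<close> is symmetric, this adds no adjacency that \<open>T\<close> lacks.\<close>
    have "arcs_ends (mk_symmetric H) \<subseteq> {(a, b) \<in> arcs_ends T. v \<in> B a \<and> v \<in> B b}"
    proof
      fix e assume "e \<in> arcs_ends (mk_symmetric H)"
      then obtain c where c: "c \<in> arcs T" "v \<in> B (tail T c)" "v \<in> B (head T c)"
        and e: "e = (tail T c, head T c) \<or> e = (head T c, tail T c)"
        unfolding H_def by (auto simp: arcs_ends_conv parcs_mk_symmetric)
      have "(tail T c, head T c) \<in> arcs_ends T" using c(1) unfolding arcs_ends_conv by blast
      then show "e \<in> {(a, b) \<in> arcs_ends T. v \<in> B a \<and> v \<in> B b}"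
        using e c(2,3) T.graph_symmetric by blast
    qed
    moreover have "(y, z) \<in> (arcs_ends (mk_symmetric H))\<^sup>*"
    proof (rule reachable_rtranclI)
      have "y \<in> verts (mk_symmetric H)" "z \<in> verts (mk_symmetric H)"
        using y z vy vz unfolding H_def by simp_all
      then show "y \<rightarrow>\<^sup>*\<^bsub>mk_symmetric H\<^esub> z"
        using conn[OF v] unfolding connected_def strongly_connected_def H_def by blast
    qed
    ultimately have "(y, z) \<in> {(a, b) \<in> arcs_ends T. v \<in> B a \<and> v \<in> B b}\<^sup>*"
      using rtrancl_mono by blast
    then obtain a b where ab: "(a, b) \<in> arcs_ends T" "v \<in> B a" "v \<in> B b"
      "(a, x) \<in> P\<^sup>*" "(b, x) \<notin> P\<^sup>*"
      using rtrancl_crossing[of y z _ "{u. (u, x) \<in> P\<^sup>*}"] yx zx by blast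
    \<comment> \<open>A child of \<open>a\<close> would lie below \<open>x\<close>, so
      \<open>b\<close> is the parent of \<open>a\<close>. Were \<open>a\<close> strictly below
      \<open>x\<close>, its parent would still be below \<open>x\<close>.\<close>
    have "(b, a) \<notin> P" using ab(4,5) by (meson converse_rtrancl_into_rtrancl)
    then have "(a, b) \<in> P" using P(1) ab(1) by simp
    moreover have "a = x"
    proof (rule ccontr)
      assume "a \<noteq> x"
      with ab(4) obtain c where "(a, c) \<in> P" "(c, x) \<in> P\<^sup>*" by (meson converse_rtranclE)
      then show False using \<open>(a, b) \<in> P\<close> P(2) ab(5) unfolding single_valued_def by blast
    qed
    ultimately show "v \<in> B x \<and> v \<in> B w" using ab xw P(2) unfolding single_valued_def by blast
  qed (fact G.finite_verts T.finite_verts r P(2,4,5))+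
  then show ?thesis using that by blast
qed

section \<open>Tree-width and components\<close>

text \<open>It makes the set of widths nonempty, as reasoning about its infimum requires.\<close>

lemma trivial_tree_decomposition:
  fixes G :: "('a, 'b) pre_digraph" and x :: 't
  assumes "graph G"
  shows "tree_decomposition G (with_proj \<lparr>pverts = {x}, parcs = {}\<rparr>) (\<lambda>_. verts G)"
proof -
  interpret G: graph G by fact
  define T where "T = with_proj \<lparr>pverts = {x}, parcs = {}\<rparr>"
  have "graph T"
    by unfold_locales (auto simp: T_def symmetric_def arcs_ends_conv sym_def)
  moreover have conn: "connected (T \<restriction> {y \<in> verts T. v \<in> verts G})" if "v \<in> verts G" for v
    using that unfolding connected_def strongly_connected_def reachable_def T_def
    by (auto intro: rtrancl_on.intros)
  moreover have "connected T"
    unfolding connected_def strongly_connected_def reachable_def T_def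
    by (auto intro: rtrancl_on.intros)
  moreover have "\<not> pre_digraph.cycle T c" for c
    unfolding pre_digraph.cycle_def pre_digraph.awalk_def T_def by auto
  ultimately have "tree_decomposition G T (\<lambda>_. verts G)"
    unfolding tree_decomposition_def undirected_tree_def
    using G.adj_in_verts by (auto simp: T_def)
  then show ?thesis unfolding T_def .
qed

lemma treewidth_leE:
  fixes G :: "('a, 'b) pre_digraph"
  assumes G: "graph G" and "treewidth G \<le> w"
  obtains T :: "nat pair_pre_digraph" and B where
    "tree_decomposition G (with_proj T) B" "\<And>x. x \<in> pverts T \<Longrightarrow> int (card (B x)) \<le> w + 1"
proof -
  define Ws where "Ws = {decomposition_width (with_proj T) B | (T :: nat pair_pre_digraph) B.
            tree_decomposition G (with_proj T) B}"
  have "Ws \<noteq> {}" using trivial_tree_decomposition[OF G, of "0 :: nat"] unfolding Ws_def by blast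
  moreover have "bdd_below Ws"
  proof (rule bdd_belowI[of _ "-1"])
    show "-1 \<le> v" if "v \<in> Ws" for v
      using that unfolding Ws_def decomposition_width_def by auto
  qed
  \<comment> \<open>The strict bound yields a width \<open>v < w + 1\<close>, which for integers
    means at most \<open>w\<close>.\<close>
  moreover have "Inf Ws < w + 1" using assms(2) unfolding treewidth_def Ws_def by simp
  ultimately obtain v where "v \<in> Ws" "v < w + 1" using cInf_less_iff by blast
  then obtain T :: "nat pair_pre_digraph" and B where
    td: "tree_decomposition G (with_proj T) B" and le: "decomposition_width (with_proj T) B \<le> w"
    unfolding Ws_def by auto
  interpret T: graph "with_proj T"
    using td unfolding tree_decomposition_def undirected_tree_def by simp
  have "int (card (B x)) \<le> w + 1" if "x \<in> pverts T" for x
  proof -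
    have "card (B x) \<le> Max ((\<lambda>x. card (B x)) ` pverts T)"
      using that T.finite_verts by (intro Max_ge) auto
    then show ?thesis using le unfolding decomposition_width_def by simp
  qed
  with td that show ?thesis by blast
qed

text \<open>The closed set around one vertex of \<open>C\<close> contains everything reachable from
  it within \<open>W\<close>, hence all of \<open>C\<close>.\<close>

lemma scc_card_le_if_small_pieces:
  assumes "graph G" "W \<subseteq> verts G" and small: "small_pieces (arcs_ends G) q W"
    and C: "C \<in> pre_digraph.sccs (G \<restriction> W)"
  shows "card (verts C) \<le> q"
proof -
  interpret G: graph G by fact
  have ind: "induced_subgraph C (G \<restriction> W)" and sc: "strongly_connected C"
    using C unfolding pre_digraph.sccs_def by simp_all
  then have CW: "verts C \<subseteq> W"
    unfolding induced_subgraph_def subgraph_def by simp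
  have ends: "arcs_ends C \<subseteq> arcs_ends G \<inter> W \<times> W"
    using ind unfolding induced_subgraph_def subgraph_def compatible_def
    by (auto simp: arcs_ends_conv)
  obtain u where u: "u \<in> verts C" using sc unfolding strongly_connected_def by blast
  with CW have "u \<in> W" by blast
  from small_piecesE[OF small this] obtain D where D: "D \<subseteq> W" "u \<in> D" "card D \<le> q"
    "\<And>a b. a \<in> D \<Longrightarrow> b \<in> W \<Longrightarrow> (a, b) \<in> arcs_ends G \<Longrightarrow> b \<in> D" by metis
  have "verts C \<subseteq> D"
  proof
    fix v assume "v \<in> verts C"
    with sc u have "(u, v) \<in> (arcs_ends C)\<^sup>*"
      using reachable_rtranclI[of C u v] unfolding strongly_connected_def by simp
    then show "v \<in> D"
    proof (induction rule: rtrancl_induct)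
      case (step a b)
      then show ?case using D(4)[of a b] ends by blast
    qed (fact D(2))
  qed
  \<comment> \<open>As \<open>card\<close> is 0 on infinite sets, the bound on \<open>card D\<close>
    is informative only for finite \<open>D\<close>.\<close>
  moreover have "finite D" using finite_subset[OF subset_trans[OF D(1) assms(2)] G.finite_verts] .
  ultimately show ?thesis using D(3) card_mono[of D "verts C"] by simp
qed

theorem theorem22:
  fixes p q k n :: nat and G :: "('a, 'b) pre_digraph"
  assumes "int n \<le> int (p div (k + 1)) * (int q + 1) + int q + int k - 1"
    and "p \<ge> k + 1"
    and "graph G"
    and "card (verts G) = n"
    and "treewidth G \<le> int k"
  shows "\<exists>S \<subseteq> verts G. card S \<le> p \<and>
           (\<forall>C \<in> pre_digraph.sccs (G \<restriction> (verts G - S)). card (verts C) \<le> q)"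
proof -
  obtain T :: "nat pair_pre_digraph" and B where
    td: "tree_decomposition G (with_proj T) B" and
    width: "\<And>x. x \<in> pverts T \<Longrightarrow> int (card (B x)) \<le> int k + 1"
    using treewidth_leE assms(3,5) by blast
  obtain P d r where
    "rooted_decomposition (verts G) (arcs_ends G) (verts (with_proj T)) P d r B"
    using rooted_decomposition_exists[OF assms(3) td] by blast
  then interpret rooted_decomposition "verts G" "arcs_ends G" "verts (with_proj T)" P d r B .
  \<comment> \<open>The number of rounds that \<open>p\<close> deletions can pay for.\<close>
  define t where "t = p div (k + 1)"
  have bags: "card (verts G \<inter> B x) \<le> k + 1" if "x \<in> verts (with_proj T)" for x
  proof -
    have "verts G \<inter> B x = B x" using that td unfolding tree_decomposition_def by blast
    then show ?thesis using width[of x] that by simp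
  qed
  have "t \<ge> 1" using div_le_mono[OF assms(2), of "k + 1"] unfolding t_def by simp
  \<comment> \<open>The \<open>- 1\<close> of the integer bound becomes strictness, which avoids
    subtraction on naturals.\<close>
  moreover have "int n < int (t * (q + 1) + q + k)"
    using assms(1) unfolding t_def[symmetric] by (simp add: algebra_simps)
  then have "card (verts G) < t * (q + 1) + q + k" unfolding assms(4) by linarith
  ultimately obtain S where S: "S \<subseteq> verts G" "card S \<le> t * (k + 1)"
    "small_pieces (arcs_ends G) q (verts G - S)"
    using small_pieces_after_deletion[OF bags subset_refl] by blast
  have "card S \<le> p" using S(2) unfolding t_def by (metis div_times_less_eq_dividend le_trans)
  with S show ?thesis
    using scc_card_le_if_small_pieces[OF assms(3) Diff_subset S(3)] by blast
qed

end
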